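(* Let $n\ge 2$, let $H_n^4$ be any graph in $\mathscr{H}_n^4$, and let $m$ be an integer with $1\le m\le 2^n$. Then $ex_m(H_n^4)=f(m)$, where, writing $m=\sum_{i=0}^{s}2^{t_i}$ with $t_0>t_1>\cdots>t_s\ge 0$ (binary expansion), $p=\lfloor m/4\rfloor$ and $q=m-4p$, $$f(m)=\begin{cases}\sum_{i=0}^{s}t_i2^{t_i}+\sum_{i=0}^{s}2i\,2^{t_i}+4p & \text{if } 0\le q\le 2,\\ \sum_{i=0}^{s}t_i2^{t_i}+\sum_{i=0}^{s}2i\,2^{t_i}+4p+2 & \text{if } q=3.\end{cases}$$
   Context: The family $\mathscr{H}_n^4$ ($n\ge 2$) of $n$-dimensional $K_4$-hypercubes is defined recursively: $\mathscr{H}_2^4=\{K_4\}$; for $n\ge 3$, a graph belongs to $\mathscr{H}_n^4$ if and only if (up to isomorphism) it is obtained from two vertex-disjoint graphs $G_0,G_1\in\mathscr{H}_{n-1}^4$ (not necessarily isomorphic) by adding an arbitrary perfect matching between $V(G_0)$ and $V(G_1)$. For a graph $G$ and integer $m$, $ex_m(G)$ is the maximum, over all $X\subseteq V(G)$ with $|X|=m$, of the sum of degrees in the induced subgraph $G[X]$, i.e. $\max_{|X|=m}2|E(G[X])|$. *)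

theory Defs
  imports "Graph_Theory.Graph_Theory"
begin

text \<open>
  A simple graph is represented as in the session Graph-Theory: a finite, loop-free digraph on
  pairs whose arc relation is symmetric (locale \<^locale>\<open>pair_graph\<close>). An undirected
  edge \<open>uv\<close> is the pair of arcs \<open>(u,v)\<close>, \<open>(v,u)\<close>, so the degree of a vertex is its
  \<^const>\<open>out_degree\<close>, and twice the number of edges is the number of arcs.
\<close>

definition perfect_matching_between :: "('a \<times> 'a) set \<Rightarrow> 'a set \<Rightarrow> 'a set \<Rightarrow> bool" where
  "perfect_matching_between M A B \<longleftrightarrow>
     M \<subseteq> A \<times> B \<and> (\<forall>u\<in>A. \<exists>!v. (u, v) \<in> M) \<and> (\<forall>v\<in>B. \<exists>!u. (u, v) \<in> M)"

definition join_by ::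
  "('a \<times> 'a) set \<Rightarrow> 'a pair_pre_digraph \<Rightarrow> 'a pair_pre_digraph \<Rightarrow> 'a pair_pre_digraph" where
  "join_by M G0 G1 =
     \<lparr> pverts = pverts G0 \<union> pverts G1, parcs = parcs G0 \<union> parcs G1 \<union> M \<union> M\<inverse> \<rparr>"

text \<open>
  No separate closure under isomorphism is needed: the base case admits every copy of the
  complete graph on four vertices, and an isomorphic copy of a join is again a join of isomorphic
  copies (lemma \<open>K4_hypercube_iso\<close> below).
\<close>

inductive K4_hypercube :: "nat \<Rightarrow> 'a pair_pre_digraph \<Rightarrow> bool" where
  base: "complete_digraph 4 (with_proj G) \<Longrightarrow> K4_hypercube 2 G"
| step: "\<lbrakk> n \<ge> 3; K4_hypercube (n - 1) G0; K4_hypercube (n - 1) G1;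
           pverts G0 \<inter> pverts G1 = {};
           perfect_matching_between M (pverts G0) (pverts G1) \<rbrakk>
         \<Longrightarrow> K4_hypercube n (join_by M G0 G1)"

text \<open>
  Only meaningful for \<open>m \<le> card (pverts G)\<close>: otherwise the maximum is taken over the empty set.
\<close>

definition ex_deg :: "nat \<Rightarrow> 'a pair_pre_digraph \<Rightarrow> nat" where
  "ex_deg m G = Max {(\<Sum>v\<in>X. out_degree (with_proj G \<restriction> X) v) |X. X \<subseteq> pverts G \<and> card X = m}"

lemma pair_graph_join_by:
  assumes "pair_graph G0" "pair_graph G1" "pverts G0 \<inter> pverts G1 = {}"
    and "perfect_matching_between M (pverts G0) (pverts G1)"
  shows "pair_graph (join_by M G0 G1)"
proof -
  interpret G0: pair_graph G0 by fact
  interpret G1: pair_graph G1 by fact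
  have M: "M \<subseteq> pverts G0 \<times> pverts G1"
    using assms(4) by (simp add: perfect_matching_between_def)
  then have fin: "finite M"
    using G0.pair_finite_verts G1.pair_finite_verts by (meson finite_SigmaI finite_subset)
  have sub: "parcs G0 \<subseteq> pverts G0 \<times> pverts G0" "parcs G1 \<subseteq> pverts G1 \<times> pverts G1"
    by (auto intro: G0.in_arcsD1 G0.in_arcsD2 G1.in_arcsD1 G1.in_arcsD2)
  have "sym (parcs G0)" "sym (parcs G1)"
    using G0.pair_sym_arcs G1.pair_sym_arcs by (simp_all add: symmetric_def)
  then have sym: "sym (parcs G0 \<union> parcs G1 \<union> (M \<union> M\<inverse>))"
    by (intro sym_Un sym_Un_converse)
  show ?thesis
  proof
    fix e assume "e \<in> parcs (join_by M G0 G1)"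
    then have e: "e \<in> parcs G0 \<or> e \<in> parcs G1 \<or> e \<in> M \<or> prod.swap e \<in> M"
      by (cases e) (auto simp: join_by_def)
    then show "fst e \<in> pverts (join_by M G0 G1)" "snd e \<in> pverts (join_by M G0 G1)"
      using M sub by (cases e; auto simp: join_by_def)+
    show "fst e \<noteq> snd e"
      using e M assms(3) G0.pair_no_loops[of e] G1.pair_no_loops[of e] by (cases e) auto
  next
    show "finite (pverts (join_by M G0 G1))" "finite (parcs (join_by M G0 G1))"
      using fin G0.pair_finite_verts G1.pair_finite_verts G0.pair_finite_arcs G1.pair_finite_arcs
      by (simp_all add: join_by_def)
    show "symmetric (with_proj (join_by M G0 G1))"
      using sym by (simp add: join_by_def symmetric_def Un_assoc)
  qed
qed

lemma K4_hypercube_pair_graph: "K4_hypercube n G \<Longrightarrow> pair_graph G"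
proof (induction rule: K4_hypercube.induct)
  case (base G)
  then have fin: "finite (pverts G)"
    and arcs: "parcs G = {(u, v). (u, v) \<in> pverts G \<times> pverts G \<and> u \<noteq> v}"
    unfolding complete_digraph_pair_def by blast+
  have sub: "parcs G \<subseteq> pverts G \<times> pverts G"
    by (subst arcs) blast
  have "sym (parcs G)"
    by (subst arcs) (auto simp: sym_def)
  moreover have "fst e \<noteq> snd e" if "e \<in> parcs G" for e
    using that by (subst (asm) arcs) (simp add: case_prod_beta)
  moreover have "finite (parcs G)"
    using sub fin by (meson finite_SigmaI finite_subset)
  ultimately show ?case
    using fin sub by unfold_locales (auto simp only: symmetric_def with_proj_simps mem_Times_iff subset_iff)
next
  case (step n G0 G1 M)
  from step.IH step.hyps(4,5) show ?case by (rule pair_graph_join_by)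
qed

lemma K4_hypercube_iso:
  assumes "K4_hypercube n G" "inj_on f (pverts G)"
  shows "K4_hypercube n \<lparr> pverts = f ` pverts G, parcs = map_prod f f ` parcs G \<rparr>"
  using assms
proof (induction rule: K4_hypercube.induct)
  case (base G)
  then have fin: "finite (pverts G)" and card: "card (pverts G) = 4"
    and arcs: "parcs G = {(u, v). (u, v) \<in> pverts G \<times> pverts G \<and> u \<noteq> v}"
    unfolding complete_digraph_pair_def by blast+
  have "map_prod f f ` {(u, v). (u, v) \<in> pverts G \<times> pverts G \<and> u \<noteq> v}
      = {(u, v). (u, v) \<in> f ` pverts G \<times> f ` pverts G \<and> u \<noteq> v}"
    using base.prems by (force simp: inj_on_def image_iff)
  then have "map_prod f f ` parcs G
      = {(u, v). (u, v) \<in> f ` pverts G \<times> f ` pverts G \<and> u \<noteq> v}"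
    by (simp only: flip: arcs)
  then have "complete_digraph 4
      (with_proj \<lparr> pverts = f ` pverts G, parcs = map_prod f f ` parcs G \<rparr>)"
    unfolding complete_digraph_pair_def
    using fin card base.prems by (simp only: pair_pre_digraph.select_convs card_image finite_imageI)
  then show ?case
    by (rule K4_hypercube.base)
next
  case (step n G0 G1 M)
  let ?im = "\<lambda>G. \<lparr> pverts = f ` pverts G, parcs = map_prod f f ` parcs G \<rparr>"
  let ?M = "map_prod f f ` M"
  have inj: "inj_on f (pverts G0 \<union> pverts G1)"
    using step.prems by (simp add: join_by_def)
  have M: "M \<subseteq> pverts G0 \<times> pverts G1" "\<forall>u\<in>pverts G0. \<exists>!v. (u, v) \<in> M"
    "\<forall>v\<in>pverts G1. \<exists>!u. (u, v) \<in> M"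
    using step.hyps by (auto simp: perfect_matching_between_def)
  have M_iff: "(f u, f v) \<in> ?M \<longleftrightarrow> (u, v) \<in> M" if uv: "u \<in> pverts G0" "v \<in> pverts G1" for u v
  proof
    assume "(f u, f v) \<in> ?M"
    then obtain a b where ab: "(a, b) \<in> M" "f u = f a" "f v = f b" by auto
    then have "u = a" "v = b"
      using uv M(1) by (auto intro!: inj_onD[OF inj])
    with ab show "(u, v) \<in> M" by simp
  next
    assume "(u, v) \<in> M"
    then show "(f u, f v) \<in> ?M" by (metis imageI map_prod_simp)
  qed
  have M_sub: "?M \<subseteq> f ` pverts G0 \<times> f ` pverts G1"
    using M(1) by auto
  have "perfect_matching_between ?M (f ` pverts G0) (f ` pverts G1)"
    unfolding perfect_matching_between_def
  proof (intro conjI ballI M_sub)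
    fix x assume "x \<in> f ` pverts G0"
    then obtain u where u: "u \<in> pverts G0" "x = f u" by auto
    then obtain v where v: "(u, v) \<in> M" "\<And>v'. (u, v') \<in> M \<Longrightarrow> v' = v" using M(2) by metis
    show "\<exists>!y. (x, y) \<in> ?M"
    proof (rule ex1I[of _ "f v"])
      show "(x, f v) \<in> ?M" using u v M_iff M(1) by blast
    next
      fix y assume y: "(x, y) \<in> ?M"
      then obtain v' where v': "v' \<in> pverts G1" "y = f v'" using M_sub by blast
      then have "(u, v') \<in> M" using y u M_iff[of u v'] by simp
      then show "y = f v" using v(2) v'(2) by simp
    qed
  next
    fix y assume "y \<in> f ` pverts G1"
    then obtain v where v: "v \<in> pverts G1" "y = f v" by auto
    then obtain u where u: "(u, v) \<in> M" "\<And>u'. (u', v) \<in> M \<Longrightarrow> u' = u" using M(3) by metis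
    show "\<exists>!x. (x, y) \<in> ?M"
    proof (rule ex1I[of _ "f u"])
      show "(f u, y) \<in> ?M" using u v M_iff M(1) by blast
    next
      fix x assume x: "(x, y) \<in> ?M"
      then obtain u' where u': "u' \<in> pverts G0" "x = f u'" using M_sub by blast
      then have "(u', v) \<in> M" using x v M_iff[of u' v] by simp
      then show "x = f u" using u(2) u'(2) by simp
    qed
  qed
  moreover have "f ` pverts G0 \<inter> f ` pverts G1 = {}"
    using inj_on_image_Int[OF inj, of "pverts G0" "pverts G1"] step.hyps by simp
  moreover have "inj_on f (pverts G0)" "inj_on f (pverts G1)"
    using inj by (auto intro: inj_on_subset)
  ultimately have "K4_hypercube n (join_by ?M (?im G0) (?im G1))"
    using step.hyps step.IH by (intro K4_hypercube.step) simp_all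
  moreover have "?M\<inverse> = map_prod f f ` (M\<inverse>)"
    by force
  then have "join_by ?M (?im G0) (?im G1) = ?im (join_by M G0 G1)"
    by (simp add: join_by_def image_Un)
  ultimately show ?case by simp
qed

end

theory Submission
  imports Defs
begin

text \<open>
  Let \<open>S m\<close> be the total number of binary digits 1 in \<open>0, \<dots>, m - 1\<close>. The value in the theorem is
  \<open>f m = 2 S m + 4 (m div 4) + 2 [m mod 4 = 3]\<close>. Halving gives
  \<open>S x + S y + min x y \<le> S (x + y)\<close>; sorting by residues modulo 4 carries this over to
  \<open>f x + f y + 2 min x y \<le> f (x + y)\<close>, with equality if \<open>x = 2 ^ k\<close> and \<open>k \<ge> 2\<close>, \<open>y \<le> x\<close>.
  Splitting a vertex set along the two halves of a join, the inequality is the inductive step of the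
  upper bound, and the case of equality is that of the construction of extremal sets
  (one half completely, the rest in the other half).
\<close>

section \<open>The binary digit sum and its superadditivity\<close>

text \<open>Below \<open>n\<close> there are \<open>Suc n div 2\<close> even numbers
  \<open>2 * j\<close> and \<open>n div 2\<close> odd numbers \<open>2 * j + 1\<close>. Each has the
  ones of \<open>j\<close>, and an odd number has one more; hence the recursion.\<close>

fun digit_sum :: "nat \<Rightarrow> nat" where
  "digit_sum n = (if n \<le> 1 then 0
     else digit_sum (n div 2) + digit_sum (Suc n div 2) + n div 2)"

declare digit_sum.simps [simp del]

lemma digit_sum_0 [simp]: "digit_sum 0 = 0"
  and digit_sum_1 [simp]: "digit_sum (Suc 0) = 0"
  by (simp_all add: digit_sum.simps)

lemma digit_sum_double: "digit_sum (2 * x) = 2 * digit_sum x + x"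
  by (cases "x = 0") (simp_all add: digit_sum.simps[of "2 * x"])

lemma digit_sum_Suc_double: "digit_sum (Suc (2 * x)) = digit_sum x + digit_sum (Suc x) + x"
  by (cases "x = 0") (simp_all add: digit_sum.simps[of "Suc (2 * x)"])

lemma digit_sum_superadditive: "digit_sum x + digit_sum y + min x y \<le> digit_sum (x + y)"
proof (induction "x + y" arbitrary: x y rule: less_induct)
  case less
  obtain a b where ab: "x = 2 * a \<or> x = Suc (2 * a)" "y = 2 * b \<or> y = Suc (2 * b)"
    by (metis Suc_eq_plus1 evenE oddE)
  show ?case
  \<comment> \<open>Halving decreases the sum only from 2 on: for \<open>x + y = 1\<close> the pair
    with a rounded-up half would have the same sum again.\<close>
  proof (cases "x + y \<le> 1")
    case True
    then have "x = 0 \<or> y = 0" by linarith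
    then show ?thesis by auto
  next
    case False
    consider "x = 2 * a" "y = 2 * b" | "x = Suc (2 * a)" "y = 2 * b"
      | "x = 2 * a" "y = Suc (2 * b)" | "x = Suc (2 * a)" "y = Suc (2 * b)"
      using ab by blast
    then show ?thesis
    proof cases
      case 1
      have eq: "2 * a + 2 * b = 2 * (a + b)" by simp
      have "digit_sum a + digit_sum b + min a b \<le> digit_sum (a + b)"
        using False 1 by (intro less) linarith
      then show ?thesis
        unfolding 1 eq unfolding digit_sum_double by linarith
    next
      case 2
      have eq: "Suc (2 * a) + 2 * b = Suc (2 * (a + b))" by simp
      have "digit_sum a + digit_sum b + min a b \<le> digit_sum (a + b)"
        "digit_sum (Suc a) + digit_sum b + min (Suc a) b \<le> digit_sum (Suc a + b)"
        using False 2 by (intro less, linarith)+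
      then show ?thesis
        unfolding 2 eq unfolding digit_sum_double digit_sum_Suc_double add_Suc by linarith
    next
      case 3
      have eq: "2 * a + Suc (2 * b) = Suc (2 * (a + b))" by simp
      have "digit_sum a + digit_sum b + min a b \<le> digit_sum (a + b)"
        "digit_sum a + digit_sum (Suc b) + min a (Suc b) \<le> digit_sum (a + Suc b)"
        using False 3 by (intro less, linarith)+
      then show ?thesis
        unfolding 3 eq unfolding digit_sum_double digit_sum_Suc_double add_Suc_right by linarith
    next
      case 4
      have eq: "Suc (2 * a) + Suc (2 * b) = 2 * Suc (a + b)" by simp
      \<comment> \<open>The halves are paired crosswise, rounding up only one of them, so that both
        sums equal \<open>Suc (a + b)\<close>, the only value in the unfolded right-hand
        side.\<close>
      have "digit_sum a + digit_sum (Suc b) + min a (Suc b) \<le> digit_sum (a + Suc b)"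
        "digit_sum (Suc a) + digit_sum b + min (Suc a) b \<le> digit_sum (Suc a + b)"
        using False 4 by (intro less, linarith)+
      then show ?thesis
        unfolding 4 eq unfolding digit_sum_double digit_sum_Suc_double add_Suc add_Suc_right by linarith
    qed
  qed
qed

text \<open>Among all words of \<open>k\<close> binary digits, each position holds a one exactly
  half of the time.\<close>

lemma digit_sum_power2: "2 * digit_sum (2 ^ k) = k * 2 ^ k"
  by (induction k) (simp_all add: digit_sum_double)

text \<open>The numbers from \<open>2 ^ k\<close> to \<open>2 ^ k + r - 1\<close> are those below
  \<open>r\<close> with a leading one put in front, which adds \<open>r\<close> ones.\<close>

lemma digit_sum_power2_add:
  "r \<le> 2 ^ k \<Longrightarrow> digit_sum (2 ^ k + r) = digit_sum (2 ^ k) + digit_sum r + r"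
proof (induction k arbitrary: r)
  case 0
  then have "r = 0 \<or> r = Suc 0" by auto
  then show ?case using digit_sum_double[of 1] by (auto simp: numeral_2_eq_2)
next
  case (Suc k)
  show ?case
  proof (cases "even r")
    case True
    then obtain a where a: "r = 2 * a" by blast
    then have eq: "2 ^ Suc k + r = 2 * (2 ^ k + a)" by simp
    show ?thesis
      using Suc.IH[of a] Suc.prems a
      unfolding eq digit_sum_double unfolding a digit_sum_double by (simp add: digit_sum_double)
  next
    case False
    then obtain a where a: "r = Suc (2 * a)" using oddE by fastforce
    have eq: "2 ^ Suc k + r = Suc (2 * (2 ^ k + a))" using a by simp
    \<comment> \<open>An odd \<open>r\<close> cannot equal \<open>2 ^ Suc k\<close>, so the bound is
      strict and the induction hypothesis covers both \<open>a\<close> and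
      \<open>Suc a\<close>.\<close>
    have "a < 2 ^ k" using Suc.prems a by simp
    with Suc.IH[of a] Suc.IH[of "Suc a"] show ?thesis
      unfolding eq digit_sum_Suc_double unfolding a digit_sum_Suc_double
      by (simp add: digit_sum_double)
  qed
qed

text \<open>Serves to show that the tail of a binary expansion is at most the leading power, as
  \<open>digit_sum_power2_add\<close> requires.\<close>

lemma sum_decreasing_powers2_less:
  fixes t :: "nat \<Rightarrow> nat"
  assumes "\<forall>i<s. t i > t (Suc i)"
  shows "(\<Sum>i=0..s. 2 ^ t i :: nat) < 2 * 2 ^ t 0"
  using assms
proof (induction s arbitrary: t)
  case (Suc s)
  have "(\<Sum>i=0..s. 2 ^ t (Suc i) :: nat) < 2 * 2 ^ t (Suc 0)"
    using Suc.IH[of "\<lambda>i. t (Suc i)"] Suc.prems by auto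
  also have "\<dots> = 2 ^ Suc (t (Suc 0))" by simp
  also have "\<dots> \<le> 2 ^ t 0"
    using Suc.prems by (intro power_increasing) auto
  finally show ?case
    by (simp add: sum.atLeast0_atMost_Suc_shift del: sum.cl_ivl_Suc)
qed simp

text \<open>Splitting off the leading power adds the whole remaining tail once. Thus
  \<open>2 ^ t i\<close> is added once for each of the \<open>i\<close> larger powers, which
  explains the second sum.\<close>

lemma digit_sum_binary_expansion:
  fixes t :: "nat \<Rightarrow> nat"
  assumes "\<forall>i<s. t i > t (Suc i)"
  shows "2 * digit_sum (\<Sum>i=0..s. 2 ^ t i)
    = (\<Sum>i=0..s. t i * 2 ^ t i) + (\<Sum>i=0..s. 2 * i * 2 ^ t i)"
  using assms
proof (induction s arbitrary: t)
  case (Suc s)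
  let ?r = "\<Sum>i=0..s. 2 ^ t (Suc i) :: nat"
  have dec: "\<forall>i<s. t (Suc i) > t (Suc (Suc i))" using Suc.prems by auto
  have "?r < 2 * 2 ^ t (Suc 0)"
    using sum_decreasing_powers2_less[OF dec] .
  also have "\<dots> = 2 ^ Suc (t (Suc 0))" by simp
  also have "\<dots> \<le> 2 ^ t 0"
    using Suc.prems by (intro power_increasing) auto
  finally have "2 * digit_sum (2 ^ t 0 + ?r) = t 0 * 2 ^ t 0 + 2 * digit_sum ?r + 2 * ?r"
    by (simp add: digit_sum_power2_add digit_sum_power2)
  \<comment> \<open>In the full expansion every index of the tail is larger by one; this shift
    accounts for the summand \<open>2 * ?r\<close>.\<close>
  moreover have "(\<Sum>i=0..s. 2 * Suc i * 2 ^ t (Suc i)) = (\<Sum>i=0..s. 2 * i * 2 ^ t (Suc i)) + 2 * ?r"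
    by (simp add: sum_distrib_left sum.distrib)
  ultimately show ?case
    using Suc.IH[OF dec]
    by (simp add: sum.atLeast0_atMost_Suc_shift del: sum.cl_ivl_Suc mult_Suc_right)
qed (simp add: digit_sum_power2)

section \<open>The extremal function\<close>

text \<open>The term \<open>2 * digit_sum m\<close> is the corresponding maximum for the ordinary
  hypercube. The rest counts arcs on diagonals of 4-cycles: four for each complete block of four
  vertices, two for a remaining block of three.\<close>

definition ex_value :: "nat \<Rightarrow> nat" where
  "ex_value m = 2 * digit_sum m + 4 * (m div 4) + (if m mod 4 = 3 then 2 else 0)"

text \<open>Halving \<open>4 * p + q\<close> twice leaves only the arguments \<open>p\<close> and
  \<open>Suc p\<close>, so for each residue the value is linear in the digit sums at these two
  points.\<close>

lemma ex_value_residues: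
  "ex_value (4 * p) = 8 * digit_sum p + 12 * p"
  "ex_value (4 * p + 1) = 6 * digit_sum p + 2 * digit_sum (Suc p) + 12 * p"
  "ex_value (4 * p + 2) = 4 * digit_sum p + 4 * digit_sum (Suc p) + 12 * p + 2"
  "ex_value (4 * p + 3) = 2 * digit_sum p + 6 * digit_sum (Suc p) + 12 * p + 6"
proof -
  have "digit_sum (4 * p) = 4 * digit_sum p + 4 * p"
    using digit_sum_double[of "2 * p"] digit_sum_double[of p] by simp
  moreover have "digit_sum (4 * p + 1) = 3 * digit_sum p + digit_sum (Suc p) + 4 * p"
    using digit_sum_Suc_double[of "2 * p"] digit_sum_double[of p] digit_sum_Suc_double[of p] by simp
  moreover have "digit_sum (4 * p + 2) = 2 * digit_sum p + 2 * digit_sum (Suc p) + 4 * p + 1"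
    using digit_sum_double[of "Suc (2 * p)"] digit_sum_Suc_double[of p] by simp
  moreover have "digit_sum (4 * p + 3) = digit_sum p + 3 * digit_sum (Suc p) + 4 * p + 2"
  proof -
    have "4 * p + 3 = Suc (2 * Suc (2 * p))" "Suc (Suc (2 * p)) = 2 * Suc p" by simp_all
    then show ?thesis
      by (simp only: digit_sum_Suc_double digit_sum_double)
  qed
  moreover have "(4 * p + 1) mod 4 = 1" "(4 * p + 2) mod 4 = 2" "(4 * p + 3) mod 4 = 3"
    by presburger+
  ultimately show
    "ex_value (4 * p) = 8 * digit_sum p + 12 * p"
    "ex_value (4 * p + 1) = 6 * digit_sum p + 2 * digit_sum (Suc p) + 12 * p"
    "ex_value (4 * p + 2) = 4 * digit_sum p + 4 * digit_sum (Suc p) + 12 * p + 2"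
    "ex_value (4 * p + 3) = 2 * digit_sum p + 6 * digit_sum (Suc p) + 12 * p + 6"
    unfolding ex_value_def by simp_all
qed

lemma ex_value_superadditive: "ex_value a + ex_value b + 2 * min a b \<le> ex_value (a + b)"
proof (induction a b rule: linorder_wlog)
  case (sym a b)
  then show ?case by (simp add: add.commute min.commute)
next
  case (le a b)
  define x y where "x = a div 4" and "y = b div 4"
  have "x \<le> y" using le by (simp add: x_def y_def div_le_mono)
  \<comment> \<open>This is \<open>min (Suc x) y\<close>, the only one of the four minima below that
    depends on whether \<open>x = y\<close>.\<close>
  define u where "u = (if x = y then x else Suc x)"
  have u: "x \<le> u" "x < y \<Longrightarrow> u = Suc x" by (auto simp: u_def)
  have "min (Suc x) y = u" "min x y = x" "min x (Suc y) = x"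
    using \<open>x \<le> y\<close> by (auto simp: u_def)
  then have S: "digit_sum x + digit_sum y + x \<le> digit_sum (x + y)"
    "digit_sum (Suc x) + digit_sum y + u \<le> digit_sum (Suc (x + y))"
    "digit_sum x + digit_sum (Suc y) + x \<le> digit_sum (Suc (x + y))"
    "digit_sum (Suc x) + digit_sum (Suc y) + Suc x \<le> digit_sum (Suc (Suc (x + y)))"
    using digit_sum_superadditive[of x y] digit_sum_superadditive[of "Suc x" y]
      digit_sum_superadditive[of x "Suc y"] digit_sum_superadditive[of "Suc x" "Suc y"] \<open>x \<le> y\<close>
    by simp_all
  note vals = ex_value_residues[of x] ex_value_residues[of y] ex_value_residues[of "x + y"]
    ex_value_residues[of "Suc (x + y)"]
  \<comment> \<open>Residues adding up to 4, 5 or 6 carry into the quotient.\<close>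
  have carry: "4 * (x + y) + 4 = 4 * Suc (x + y)" "4 * (x + y) + 5 = 4 * Suc (x + y) + 1"
    "4 * (x + y) + 6 = 4 * Suc (x + y) + 2" by simp_all
  have goal: "ex_value a + ex_value b + 2 * a \<le> ex_value (a + b)"
    if "a = 4 * x + q" "b = 4 * y + r" "q \<in> {0, 1, 2, 3}" "r \<in> {0, 1, 2, 3}" for q r
  proof -
    have ab: "a + b = 4 * (x + y) + (q + r)" using that by simp
    \<comment> \<open>If the quotients agree, then \<open>u\<close> is only \<open>x\<close>, but
      \<open>a \<le> b\<close> orders the residues. Either way the sixteen residue cases become
      linear consequences of \<open>S\<close>.\<close>
    have "x < y \<or> q \<le> r" using that le \<open>x \<le> y\<close> by linarith
    then have "q \<le> r \<or> u = Suc x" using u by blast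
    then show ?thesis
      using that(3,4) S u(1) unfolding ab unfolding that(1,2)
      by (elim disjE insertE emptyE)
        (simp_all only: vals carry add_0_right add_0_left numeral_plus_numeral
          one_add_one one_plus_numeral numeral_plus_one add_num_simps,
          simp_all only: add_mult_distrib2 mult_Suc_right mult_num_simps
            numeral_times_numeral mult_1_right)
  qed
  have "a = 4 * x + a mod 4" "b = 4 * y + b mod 4" by (simp_all add: x_def y_def)
  moreover have "a mod 4 \<in> {0, 1, 2, 3}" "b mod 4 \<in> {0, 1, 2, 3}" by auto
  ultimately have "ex_value a + ex_value b + 2 * a \<le> ex_value (a + b)"
    by (rule goal)
  then show ?case using le by (simp add: min_absorb1)
qed

text \<open>From \<open>k = 2\<close> on, 4 divides \<open>2 ^ k\<close>, so quotients by 4 add up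
  and the residue is that of \<open>r\<close>. For \<open>k = 1\<close> and \<open>r = 1\<close>
  equality fails: 6 against 4.\<close>

lemma ex_value_power2_add:
  assumes "2 \<le> k" "r \<le> 2 ^ k"
  shows "ex_value (2 ^ k + r) = ex_value (2 ^ k) + ex_value r + 2 * r"
proof -
  have "(2::nat) ^ k = 4 * 2 ^ (k - 2)"
    using assms(1) by (metis le_add_diff_inverse power_add power2_eq_square mult_2 numeral_Bit0)
  then obtain c :: nat where c: "2 ^ k = 4 * c" by blast
  then have "(2 ^ k + r) div 4 = 2 ^ k div 4 + r div 4" "(2 ^ k + r) mod 4 = r mod 4"
    "(2::nat) ^ k mod 4 = 0"
    by simp_all
  then show ?thesis
    unfolding ex_value_def using digit_sum_power2_add[OF assms(2)] by simp
qed

text \<open>The right-hand side is the number of arcs on \<open>m\<close> vertices of a complete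
  graph, which settles the base case for both bounds.\<close>

lemma ex_value_le_4: "m \<le> 4 \<Longrightarrow> ex_value m = m * (m - 1)"
proof -
  assume "m \<le> 4"
  then have "m \<in> {0, 1, 2, 3, 4}" by auto
  then show ?thesis
    using ex_value_residues[of 0] ex_value_residues(1)[of 1] by (auto simp: numeral_2_eq_2)
qed

section \<open>Arcs inside a vertex set\<close>

definition inner_arcs :: "'a pair_pre_digraph \<Rightarrow> 'a set \<Rightarrow> ('a \<times> 'a) set" where
  "inner_arcs G X = parcs G \<inter> X \<times> X"

text \<open>The arcs inside \<open>X\<close> are partitioned by their tails.\<close>

lemma sum_out_degree_induce:
  assumes "finite X"
  shows "(\<Sum>v\<in>X. out_degree (with_proj G \<restriction> X) v) = card (inner_arcs G X)"
proof -
  have "out_arcs (with_proj G \<restriction> X) v = {e \<in> inner_arcs G X. fst e = v}" if "v \<in> X" for v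
    using that by (auto simp: inner_arcs_def out_arcs_def)
  then have "(\<Sum>v\<in>X. out_degree (with_proj G \<restriction> X) v)
      = (\<Sum>v\<in>X. card {e \<in> inner_arcs G X. fst e = v})"
    by (simp add: out_degree_def)
  also have "\<dots> = card (\<Union>v\<in>X. {e \<in> inner_arcs G X. fst e = v})"
    using assms by (intro card_UN_disjoint[symmetric]) (auto simp: inner_arcs_def)
  also have "(\<Union>v\<in>X. {e \<in> inner_arcs G X. fst e = v}) = inner_arcs G X"
    by (auto simp: inner_arcs_def)
  finally show ?thesis .
qed

lemma card_inner_arcs_complete:
  assumes "complete_digraph k (with_proj G)" "X \<subseteq> pverts G"
  shows "card (inner_arcs G X) = card X * (card X - 1)"
proof -
  have arcs: "parcs G = {(u, v). (u, v) \<in> pverts G \<times> pverts G \<and> u \<noteq> v}" and "finite (pverts G)"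
    using assms(1) unfolding complete_digraph_pair_def by blast+
  then have fin: "finite X" using assms(2) finite_subset by blast
  have "inner_arcs G X = X \<times> X - Id_on X"
    unfolding inner_arcs_def by (subst arcs) (use assms(2) in auto)
  moreover have "Id_on X = (\<lambda>x. (x, x)) ` X" by auto
  then have "card (Id_on X) = card X" by (simp add: card_image inj_on_def)
  moreover have "Id_on X \<subseteq> X \<times> X" by auto
  ultimately show ?thesis
    using fin by (simp add: card_Diff_subset finite_subset card_cartesian_product diff_mult_distrib2)
qed

text \<open>Arcs are sorted by the halves containing their ends. A matching edge counts twice, since
  its two orientations are distinct when the halves are disjoint.\<close>

lemma card_inner_arcs_join:
  assumes "pair_graph G0" "pair_graph G1" "pverts G0 \<inter> pverts G1 = {}"
    and M: "M \<subseteq> pverts G0 \<times> pverts G1"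
    and X: "X0 \<subseteq> pverts G0" "X1 \<subseteq> pverts G1"
  shows "card (inner_arcs (join_by M G0 G1) (X0 \<union> X1))
    = card (inner_arcs G0 X0) + card (inner_arcs G1 X1) + 2 * card (M \<inter> X0 \<times> X1)"
proof -
  interpret G0: pair_graph G0 by fact
  interpret G1: pair_graph G1 by fact
  have sub: "parcs G0 \<subseteq> pverts G0 \<times> pverts G0" "parcs G1 \<subseteq> pverts G1 \<times> pverts G1"
    by (auto intro: G0.in_arcsD1 G0.in_arcsD2 G1.in_arcsD1 G1.in_arcsD2)
  have fin: "finite (inner_arcs G0 X0)" "finite (inner_arcs G1 X1)"
    by (simp_all add: inner_arcs_def)
  have "finite X0" "finite X1"
    using X G0.pair_finite_verts G1.pair_finite_verts finite_subset by blast+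
  then have finM: "finite (M \<inter> X0 \<times> X1)" by simp
  let ?N = "M \<inter> X0 \<times> X1"
  have "inner_arcs (join_by M G0 G1) (X0 \<union> X1)
      = inner_arcs G0 X0 \<union> inner_arcs G1 X1 \<union> (?N \<union> ?N\<inverse>)"
    using sub M X assms(3) unfolding inner_arcs_def join_by_def by auto
  also have "card \<dots> = card (inner_arcs G0 X0 \<union> inner_arcs G1 X1) + card (?N \<union> ?N\<inverse>)"
    using fin finM M X assms(3) by (intro card_Un_disjoint) (auto simp: inner_arcs_def)
  also have "card (inner_arcs G0 X0 \<union> inner_arcs G1 X1)
      = card (inner_arcs G0 X0) + card (inner_arcs G1 X1)"
    using fin X assms(3) by (intro card_Un_disjoint) (auto simp: inner_arcs_def)
  also have "card (?N \<union> ?N\<inverse>) = card ?N + card (?N\<inverse>)"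
    using finM X assms(3) by (intro card_Un_disjoint) auto
  finally show ?thesis by simp
qed

lemma perfect_matching_between_inj:
  assumes "perfect_matching_between M A B"
  shows "inj_on fst M" "inj_on snd M"
proof -
  have M: "M \<subseteq> A \<times> B" "\<forall>u\<in>A. \<exists>!v. (u, v) \<in> M" "\<forall>v\<in>B. \<exists>!u. (u, v) \<in> M"
    using assms by (auto simp: perfect_matching_between_def)
  then have "v = v'" if "(u, v) \<in> M" "(u, v') \<in> M" for u v v'
    using that by blast
  then show "inj_on fst M" by (auto simp: inj_on_def)
  from M have "u = u'" if "(u, v) \<in> M" "(u', v) \<in> M" for u u' v
    using that by blast
  then show "inj_on snd M" by (auto simp: inj_on_def)
qed

lemma card_matching_le:
  assumes "perfect_matching_between M A B" "finite X" "finite Y"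
  shows "card (M \<inter> X \<times> Y) \<le> min (card X) (card Y)"
proof -
  have inj: "inj_on fst (M \<inter> X \<times> Y)" "inj_on snd (M \<inter> X \<times> Y)"
    using perfect_matching_between_inj[OF assms(1)] by (auto intro: inj_on_subset)
  have "card (M \<inter> X \<times> Y) \<le> card X"
    by (rule card_inj_on_le[OF inj(1)]) (use assms(2) in auto)
  moreover have "card (M \<inter> X \<times> Y) \<le> card Y"
    by (rule card_inj_on_le[OF inj(2)]) (use assms(3) in auto)
  ultimately show ?thesis by simp
qed

text \<open>Every vertex of \<open>Y\<close> has exactly one partner, and that partner lies in
  \<open>A\<close>. This is the case in which the minimum in \<open>card_matching_le\<close> is
  reached.\<close>

lemma card_matching_full:
  assumes "perfect_matching_between M A B" "Y \<subseteq> B"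
  shows "card (M \<inter> A \<times> Y) = card Y"
proof -
  have M: "M \<subseteq> A \<times> B" "\<forall>v\<in>B. \<exists>!u. (u, v) \<in> M"
    using assms(1) by (auto simp: perfect_matching_between_def)
  have "inj_on snd (M \<inter> A \<times> Y)"
    using perfect_matching_between_inj(2)[OF assms(1)] by (rule inj_on_subset) auto
  moreover have "snd ` (M \<inter> A \<times> Y) = Y"
  proof
    show "Y \<subseteq> snd ` (M \<inter> A \<times> Y)"
    proof
      fix v assume "v \<in> Y"
      then obtain u where "(u, v) \<in> M" using M(2) assms(2) by blast
      with \<open>v \<in> Y\<close> M(1) show "v \<in> snd ` (M \<inter> A \<times> Y)" by force
    qed
  qed auto
  ultimately have "bij_betw snd (M \<inter> A \<times> Y) Y" by (simp add: bij_betw_def)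
  then show ?thesis by (rule bij_betw_same_card)
qed

section \<open>Extremal sets in K4-hypercubes\<close>

lemma K4_hypercube_card: "K4_hypercube n G \<Longrightarrow> card (pverts G) = 2 ^ n"
proof (induction rule: K4_hypercube.induct)
  case (base G)
  then show ?case unfolding complete_digraph_pair_def by simp
next
  case (step n G0 G1 M)
  \<comment> \<open>An infinite set has cardinality 0, which is not a power of two.\<close>
  have "finite (pverts G0)" "finite (pverts G1)"
    using step.IH card.infinite by fastforce+
  then have "card (pverts (join_by M G0 G1)) = 2 * 2 ^ (n - 1)"
    using step.hyps(4) step.IH by (simp add: join_by_def card_Un_disjoint)
  also have "\<dots> = 2 ^ n" using step.hyps(1) by (cases n) simp_all
  finally show ?case .
qed

lemma K4_hypercube_finite: "K4_hypercube n G \<Longrightarrow> finite (pverts G)"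
  using K4_hypercube_card[of n G] card.infinite by fastforce

lemma K4_hypercube_inner_arcs_le:
  assumes "K4_hypercube n G" "X \<subseteq> pverts G"
  shows "card (inner_arcs G X) \<le> ex_value (card X)"
  using assms
proof (induction arbitrary: X rule: K4_hypercube.induct)
  case (base G)
  have "card X \<le> 4"
    using base K4_hypercube_card[OF K4_hypercube.base[OF base(1)]]
      K4_hypercube_finite[OF K4_hypercube.base[OF base(1)]] card_mono by fastforce
  then show ?case
    using card_inner_arcs_complete[OF base] by (simp add: ex_value_le_4)
next
  case (step n G0 G1 M)
  define X0 X1 where "X0 = X \<inter> pverts G0" and "X1 = X \<inter> pverts G1"
  have X: "X = X0 \<union> X1" "X0 \<inter> X1 = {}" "X0 \<subseteq> pverts G0" "X1 \<subseteq> pverts G1"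
    using step.prems step.hyps(4) by (auto simp: X0_def X1_def join_by_def)
  have fin: "finite X0" "finite X1"
    using step.hyps(2,3)[THEN K4_hypercube_finite] by (auto simp: X0_def X1_def)
  have "card (inner_arcs (join_by M G0 G1) X)
      = card (inner_arcs G0 X0) + card (inner_arcs G1 X1) + 2 * card (M \<inter> X0 \<times> X1)"
    unfolding X(1)
    using step.hyps X by (intro card_inner_arcs_join)
      (auto simp: perfect_matching_between_def dest: K4_hypercube_pair_graph)
  also have "\<dots> \<le> ex_value (card X0) + ex_value (card X1) + 2 * min (card X0) (card X1)"
    using step.IH X card_matching_le[OF step.hyps(5) fin]
    by (intro add_mono mult_le_mono) auto
  also have "\<dots> \<le> ex_value (card X0 + card X1)"
    by (rule ex_value_superadditive)
  also have "card X0 + card X1 = card X"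
    using X fin by (simp add: card_Un_disjoint)
  finally show ?case .
qed

lemma K4_hypercube_inner_arcs_attained:
  assumes "K4_hypercube n G" "m \<le> 2 ^ n"
  shows "\<exists>X \<subseteq> pverts G. card X = m \<and> card (inner_arcs G X) = ex_value m"
  using assms
proof (induction arbitrary: m rule: K4_hypercube.induct)
  case (base G)
  have "m \<le> card (pverts G)"
    using base K4_hypercube_card[OF K4_hypercube.base[OF base(1)]] by simp
  then obtain X where "X \<subseteq> pverts G" "card X = m" by (meson obtain_subset_with_card_n)
  then show ?case
    using card_inner_arcs_complete[OF base(1)] base(2) by (auto simp: ex_value_le_4)
next
  case (step n G0 G1 M)
  have pg: "pair_graph G0" "pair_graph G1"
    using step.hyps K4_hypercube_pair_graph by blast+
  have M: "M \<subseteq> pverts G0 \<times> pverts G1"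
    using step.hyps(5) by (simp add: perfect_matching_between_def)
  note join = card_inner_arcs_join[OF pg step.hyps(4) M]
  show ?case
  proof (cases "m \<le> 2 ^ (n - 1)")
    case True
    then obtain X where X: "X \<subseteq> pverts G0" "card X = m" "card (inner_arcs G0 X) = ex_value m"
      using step.IH(1) by blast
    then show ?thesis
      using join[of X "{}"] by (intro exI[of _ X]) (auto simp: join_by_def inner_arcs_def)
  next
    case False
    define r where "r = m - 2 ^ (n - 1)"
    have m: "m = 2 ^ (n - 1) + r" using False by (simp add: r_def)
    have "(2::nat) ^ n = 2 * 2 ^ (n - 1)" using step.hyps(1) by (cases n) simp_all
    then have r: "r \<le> 2 ^ (n - 1)" using step.prems m by simp
    then obtain Y where Y: "Y \<subseteq> pverts G1" "card Y = r" "card (inner_arcs G1 Y) = ex_value r"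
      using step.IH(2) by blast
    obtain X where X: "X \<subseteq> pverts G0" "card X = 2 ^ (n - 1)"
      "card (inner_arcs G0 X) = ex_value (2 ^ (n - 1))"
      using step.IH(1)[of "2 ^ (n - 1)"] by blast
    have fin: "finite (pverts G0)" "finite (pverts G1)"
      using step.hyps(2,3)[THEN K4_hypercube_finite] .
    \<comment> \<open>A subset of full size is the whole half, so each vertex of \<open>Y\<close> is
      matched into \<open>X\<close> and contributes one matching edge.\<close>
    have "X = pverts G0"
      using X fin K4_hypercube_card[OF step.hyps(2)] by (simp add: card_subset_eq)
    then have "card (M \<inter> X \<times> Y) = r"
      using card_matching_full[OF step.hyps(5) Y(1)] Y(2) by simp
    \<comment> \<open>Here \<open>n \<ge> 3\<close> supplies the exponent
      \<open>n - 1 \<ge> 2\<close> that the equality case demands.\<close>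
    then have "card (inner_arcs (join_by M G0 G1) (X \<union> Y)) = ex_value m"
      using join[OF X(1) Y(1)] X(3) Y(3) ex_value_power2_add[OF _ r] step.hyps(1) m by simp
    moreover have "card (X \<union> Y) = m"
      using X Y fin step.hyps(4) m by (subst card_Un_disjoint) (auto intro: finite_subset)
    moreover have "X \<union> Y \<subseteq> pverts (join_by M G0 G1)"
      using X Y by (auto simp: join_by_def)
    ultimately show ?thesis by blast
  qed
qed

lemma ex_deg_K4_hypercube:
  assumes "K4_hypercube n G" "m \<le> 2 ^ n"
  shows "ex_deg m G = ex_value m"
proof -
  have fin: "finite (pverts G)" using assms(1) by (rule K4_hypercube_finite)
  have eq: "(\<Sum>v\<in>X. out_degree (with_proj G \<restriction> X) v) = card (inner_arcs G X)"
    if "X \<subseteq> pverts G" for X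
    using that fin by (intro sum_out_degree_induce) (rule finite_subset)
  let ?D = "{(\<Sum>v\<in>X. out_degree (with_proj G \<restriction> X) v) |X. X \<subseteq> pverts G \<and> card X = m}"
  have "?D \<subseteq> (\<lambda>X. \<Sum>v\<in>X. out_degree (with_proj G \<restriction> X) v) ` Pow (pverts G)" by auto
  then have "finite ?D" using fin by (meson finite_Pow_iff finite_imageI finite_subset)
  then show ?thesis
    unfolding ex_deg_def
  proof (rule Max_eqI)
    show "d \<le> ex_value m" if "d \<in> ?D" for d
      using that K4_hypercube_inner_arcs_le[OF assms(1)] eq by auto
    obtain X where X: "X \<subseteq> pverts G" "card X = m" "card (inner_arcs G X) = ex_value m"
      using K4_hypercube_inner_arcs_attained[OF assms] by blast
    then have "ex_value m = (\<Sum>v\<in>X. out_degree (with_proj G \<restriction> X) v)"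
      using eq[OF X(1)] by simp
    with X(1,2) show "ex_value m \<in> ?D" by blast
  qed
qed

theorem theorem4:
  fixes H :: "'a pair_pre_digraph"
    and n m s p q :: nat
    and t :: "nat \<Rightarrow> nat"
  assumes "n \<ge> 2"
    and "K4_hypercube n H"
    and "1 \<le> m" and "m \<le> 2 ^ n"
    and "\<forall>i<s. t i > t (Suc i)"
    and "m = (\<Sum>i=0..s. 2 ^ t i)"
    and "p = m div 4" and "q = m - 4 * p"
  shows "ex_deg m H =
    (if q \<le> 2 then (\<Sum>i=0..s. t i * 2 ^ t i) + (\<Sum>i=0..s. 2 * i * 2 ^ t i) + 4 * p
     else (\<Sum>i=0..s. t i * 2 ^ t i) + (\<Sum>i=0..s. 2 * i * 2 ^ t i) + 4 * p + 2)"
proof -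
  have "m mod 4 = q" using assms(7,8) by (simp add: minus_mult_div_eq_mod)
  moreover have "q < 4" using \<open>m mod 4 = q\<close> by auto
  ultimately have "ex_value m = 2 * digit_sum m + 4 * p + (if q \<le> 2 then 0 else 2)"
    unfolding ex_value_def assms(7) by auto
  then show ?thesis
    using ex_deg_K4_hypercube[OF assms(2,4)] digit_sum_binary_expansion[OF assms(5)]
    unfolding assms(6)[symmetric] by simp
qed

end
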